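(* For all integers $m,n\ge 0$ and all $p,q\in\mathbb{R}$, $$\mathcal{V}(h_m,h_n)(p,q)=(-1)^n(\sqrt{2})^{m+n-1}e^{-\frac{p^2+q^2}{4}}\,H_{m,n}\!\left(\frac{p+iq}{\sqrt{2}},\frac{p-iq}{\sqrt{2}}\right).$$
   Context: The Fourier-Wigner transform on $\mathbb{R}$ (dimension $d=1$) is defined, for complex-valued $f,g\in L^2(\mathbb{R})$ and $p,q\in\mathbb{R}$, by $$\mathcal{V}(f,g)(p,q)=\frac{1}{\sqrt{2\pi}}\int_{\mathbb{R}}e^{i(x+\frac p2)q}f(x+p)\overline{g(x)}\,dx .$$ The real Hermite polynomials are $H_n(x)=(-1)^n e^{x^2}\frac{d^n}{dx^n}(e^{-x^2})$, $n\ge 0$, and the Hermite functions are $h_n(x)=e^{-x^2/2}H_n(x)$. The complex Hermite polynomials $H_{m,n}(z,\overline z)$, $m,n\ge 0$ integers, $z\in\mathbb{C}$ (with $\overline z$ the complex conjugate of $z$), are defined by the generating function $$\sum_{m,n=0}^{+\infty}\frac{u^m}{m!}\frac{v^n}{n!}H_{m,n}(z,\overline z)=e^{-uv+zu+\overline z v},\qquad u,v\in\mathbb{C}.$$ *)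

theory Defs
  imports "HOL-Analysis.Analysis"
begin

text \<open>
  The measure is \<open>lebesgue\<close> rather than \<open>lborel\<close>, so that the definition also covers
  Lebesgue measurable functions that are not Borel measurable. The Bochner integral is
  total; for $f, g \in L^2$ the integrand is integrable.
\<close>

definition fourier_wigner :: "(real \<Rightarrow> complex) \<Rightarrow> (real \<Rightarrow> complex) \<Rightarrow> real \<Rightarrow> real \<Rightarrow> complex" where
  "fourier_wigner f g p q =
     1 / complex_of_real (sqrt (2 * pi)) *
     (LINT x|lebesgue. exp (\<i> * complex_of_real ((x + p / 2) * q)) * f (x + p) * cnj (g x))"

definition hermite_poly :: "nat \<Rightarrow> real \<Rightarrow> real" where
  "hermite_poly n x = (-1) ^ n * exp (x\<^sup>2) * (deriv ^^ n) (\<lambda>t. exp (- t\<^sup>2)) x"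

definition hermite_fun :: "nat \<Rightarrow> real \<Rightarrow> real" where
  "hermite_fun n x = exp (- x\<^sup>2 / 2) * hermite_poly n x"

definition is_complex_hermite_family :: "complex \<Rightarrow> complex \<Rightarrow> (nat \<Rightarrow> nat \<Rightarrow> complex) \<Rightarrow> bool" where
  "is_complex_hermite_family z w c \<longleftrightarrow>
     (\<forall>u v. ((\<lambda>(m, n). u ^ m / fact m * (v ^ n / fact n) * c m n)
              has_sum exp (- u * v + z * u + w * v)) UNIV)"

text \<open>
  \<open>complex_hermite m n z w\<close> is $H_{m,n}(z, w)$; it takes the place of $\overline z$ as
  a separate argument, so that the complex Hermite polynomial of the literature is
  \<open>complex_hermite m n z (cnj z)\<close>. The double series is summed unconditionally;
  \<open>complex_hermite_family_ex1\<close> below shows that the description is proper.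
\<close>

definition complex_hermite :: "nat \<Rightarrow> nat \<Rightarrow> complex \<Rightarrow> complex \<Rightarrow> complex" where
  "complex_hermite m n z w = (THE c. is_complex_hermite_family z w c) m n"

lemma has_sum_mult_Times:
  fixes f :: "'a \<Rightarrow> complex" and g :: "'b \<Rightarrow> complex"
  assumes f: "(f has_sum S) A" and g: "(g has_sum T) B"
  shows "((\<lambda>(x, y). f x * g y) has_sum (S * T)) (A \<times> B)"
proof (rule has_sum_SigmaI)
  show "((\<lambda>y. case (x, y) of (x, y) \<Rightarrow> f x * g y) has_sum f x * T) B" for x
    using has_sum_cmult_right[OF g, of "f x"] by simp
  show "((\<lambda>x. f x * T) has_sum S * T) A"
    using has_sum_cmult_left[OF f] by simp
  have "(\<lambda>x. norm (f x)) summable_on A" "(\<lambda>x. norm (g x)) summable_on B"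
    using f g summable_on_def summable_on_iff_abs_summable_on_complex by blast+
  hence "(\<lambda>x. norm (case x of (x, y) \<Rightarrow> f x * g y)) summable_on A \<times> B"
    unfolding Infinite_Sum.abs_summable_on_Sigma_iff
    by (auto simp: norm_mult infsum_cmult_right' infsum_nonneg
             intro!: summable_on_cmult_right summable_on_cmult_left)
  thus "(\<lambda>(x, y). f x * g y) summable_on A \<times> B"
    using summable_on_iff_abs_summable_on_complex by blast
qed

lemma has_sum_exp_complex: "((\<lambda>n. (z::complex) ^ n / fact n) has_sum exp z) UNIV"
proof (rule norm_summable_imp_has_sum)
  show "summable (\<lambda>n. norm (z ^ n / fact n))"
    using summable_norm_exp[of z] by (simp add: scaleR_conv_of_real divide_simps norm_mult norm_divide norm_power)
  show "(\<lambda>n. z ^ n / fact n) sums exp z"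
    using exp_converges[of z] by (simp add: scaleR_conv_of_real divide_simps)
qed

lemma powser_zero_imp_coeff_zero:
  fixes a :: "nat \<Rightarrow> complex"
  assumes "\<And>u. ((\<lambda>n. u ^ n * a n) has_sum 0) UNIV"
  shows "a n = 0"
proof -
  have s: "(\<lambda>n. a n * u ^ n) sums 0" for u
    using has_sum_imp_sums[OF assms[of u]] by (simp add: mult.commute)
  have "conv_radius a = \<infinity>"
    by (rule conv_radius_inftyI'') (use s sums_summable in blast)
  hence r: "fps_conv_radius (Abs_fps a) = \<infinity>"
    by (simp add: fps_conv_radius_def)
  have "eval_fps (Abs_fps a) u = 0" for u
    using s[of u] by (simp add: eval_fps_def sums_iff)
  hence "Abs_fps a = 0"
    by (intro eval_fps_eqD) (auto simp: r)
  thus ?thesis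
    by (metis fps_nth_Abs_fps fps_zero_nth)
qed

lemma complex_hermite_family_exists: "\<exists>c. is_complex_hermite_family z w c"
proof -
  define c where "c m n = (\<Sum>k\<le>min m n. fact m * fact n * (-1) ^ k / fact k *
      (z ^ (m - k) / fact (m - k)) * (w ^ (n - k) / fact (n - k)))" for m n
  have "((\<lambda>(m, n). u ^ m / fact m * (v ^ n / fact n) * c m n)
              has_sum exp (- u * v + z * u + w * v)) UNIV" for u v
  proof -
    let ?F = "\<lambda>(a, b, k). (z * u) ^ a / fact a * ((w * v) ^ b / fact b * ((- u * v) ^ k / fact k))"
    let ?G = "\<lambda>((m, n), k). u ^ m / fact m * (v ^ n / fact n) * (fact m * fact n * (-1) ^ k / fact k *
      (z ^ (m - k) / fact (m - k)) * (w ^ (n - k) / fact (n - k)))"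
    let ?B = "SIGMA (m, n):UNIV. {..min m n}"
    let ?h = "\<lambda>((m::nat, n::nat), k::nat). (m - k, n - k, k)"
    have "(?F has_sum exp (z * u) * (exp (w * v) * exp (- u * v))) (UNIV \<times> UNIV \<times> UNIV)"
      using has_sum_mult_Times[OF has_sum_exp_complex[of "z * u"]
          has_sum_mult_Times[OF has_sum_exp_complex[of "w * v"] has_sum_exp_complex[of "- u * v"]]]
      by (simp add: case_prod_unfold)
    hence F: "(?F has_sum exp (- u * v + z * u + w * v)) UNIV"
      by (simp add: mult_exp_exp algebra_simps)
    have bij: "bij_betw ?h ?B UNIV"
      by (rule bij_betw_byWitness[where f' = "\<lambda>(a, b, k). ((a + k, b + k), k)"]) auto
    have "((\<lambda>x. ?F (?h x)) has_sum exp (- u * v + z * u + w * v)) ?B"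
      using F has_sum_reindex_bij_betw[OF bij] by blast
    moreover have "?F (?h x) = ?G x" if "x \<in> ?B" for x
    proof -
      obtain m n k where x: "x = ((m, n), k)" by (metis prod.exhaust)
      with that have "k \<le> m" "k \<le> n" by auto
      then obtain a b where ab: "m = a + k" "n = b + k"
        by (metis le_add_diff_inverse2)
      have minus: "(- (u * v)) ^ k = (-1) ^ k * u ^ k * v ^ k"
        by (subst power_minus) (simp add: power_mult_distrib)
      show ?thesis
        unfolding x ab by (simp add: minus power_mult_distrib power_add mult_ac)
    qed
    ultimately have "(?G has_sum exp (- u * v + z * u + w * v)) ?B"
      by (simp cong: has_sum_cong)
    hence "((\<lambda>x. \<Sum>k\<in>(case x of (m, n) \<Rightarrow> {..min m n}). ?G (x, k))
             has_sum exp (- u * v + z * u + w * v)) UNIV"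
      by (rule has_sum_SigmaD) (auto intro!: has_sum_finite)
    thus ?thesis
      by (rule back_subst[of "\<lambda>f. (f has_sum _) UNIV"])
         (auto simp: fun_eq_iff c_def sum_distrib_left)
  qed
  thus ?thesis unfolding is_complex_hermite_family_def by blast
qed

lemma complex_hermite_family_unique:
  assumes "is_complex_hermite_family z w c" "is_complex_hermite_family z w d"
  shows "c = d"
proof -
  define e where "e m n = c m n - d m n" for m n
  have e0: "((\<lambda>(m, n). u ^ m / fact m * (v ^ n / fact n) * e m n) has_sum 0) (UNIV \<times> UNIV)" for u v
    using has_sum_add[OF assms(1)[unfolded is_complex_hermite_family_def, rule_format, of u v]
        has_sum_uminusI[OF assms(2)[unfolded is_complex_hermite_family_def, rule_format, of u v]]]
    by (simp add: e_def case_prod_unfold right_diff_distrib)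
  have row: "(\<lambda>n. v ^ n / fact n * e m n) summable_on UNIV" for v m
  proof -
    have "(\<lambda>(m, n). 1 ^ m / fact m * (v ^ n / fact n) * e m n) summable_on UNIV \<times> UNIV"
      using e0[of 1 v] summable_on_def by blast
    from summable_on_SigmaD1[OF this, of m]
    have "(\<lambda>n. (1 / fact m) * (v ^ n / fact n * e m n)) summable_on UNIV"
      by simp
    from summable_on_cmult_right[OF this, of "fact m"] show ?thesis by simp
  qed
  define R where "R v m = (\<Sum>\<^sub>\<infinity>n. v ^ n / fact n * e m n)" for v m
  have hR: "((\<lambda>n. v ^ n / fact n * e m n) has_sum R v m) UNIV" for v m
    unfolding R_def using row by (rule has_sum_infsum)
  have "((\<lambda>m. u ^ m * (R v m / fact m)) has_sum 0) UNIV" for u v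
  proof (rule has_sum_SigmaD[OF e0[of u v]])
    show "((\<lambda>y. case (m, y) of (m, n) \<Rightarrow> u ^ m / fact m * (v ^ n / fact n) * e m n)
        has_sum u ^ m * (R v m / fact m)) UNIV" for m
      using has_sum_cmult_right[OF hR[of v m], of "u ^ m / fact m"] by (simp add: mult.assoc)
  qed
  hence "R v m / fact m = 0" for v m
    by (rule powser_zero_imp_coeff_zero[where a = "\<lambda>m. R v m / fact m"])
  hence "((\<lambda>n. v ^ n * (e m n / fact n)) has_sum 0) UNIV" for v m
    using hR[of v m] by simp
  hence "e m n / fact n = 0" for m n
    by (rule powser_zero_imp_coeff_zero[where a = "\<lambda>n. e m n / fact n"])
  thus ?thesis by (auto simp: fun_eq_iff e_def)
qed

lemma complex_hermite_family_ex1: "\<exists>!c. is_complex_hermite_family z w c"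
  using complex_hermite_family_exists complex_hermite_family_unique by blast

lemma complex_hermite_generating_function:
  "((\<lambda>(m, n). u ^ m / fact m * (v ^ n / fact n) * complex_hermite m n z w)
     has_sum exp (- u * v + z * u + w * v)) UNIV"
  using theI'[OF complex_hermite_family_ex1[of z w]]
  unfolding complex_hermite_def is_complex_hermite_family_def by blast

end

theory Submission
  imports Defs "HOL-Probability.Characteristic_Functions"
begin

text \<open>
  Both sides are compared through their double generating functions in $(m,n)$. Since
  $\sum_m s^m h_m(x)/m! = e^{-x^2/2 + 2xs - s^2}$, summing
  $s^m t^n\, \mathcal V(h_m,h_n)/(m!\,n!)$ under the integral gives a Gaussian integral with
  complex linear term, equal to
  $e^{-(p^2+q^2)/4}\, e^{2st + (p+iq)s - (p-iq)t}/\sqrt 2$. With $s = u/\sqrt 2$ and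
  $t = -v/\sqrt 2$ the last exponential is $e^{-uv + zu + \overline z v}$ at
  $z = (p+iq)/\sqrt 2$, and a double power series determines its coefficients. The exchange of
  sum and integral is justified by the same generating function with all signs made positive:
  $\sum_m |s|^m |h_m(x)|/m! \le e^{-x^2/2 + 2|x||s| + |s|^2}$.
\<close>

section \<open>Exchange of unconditional sums and integrals\<close>

text \<open>A bound by \<open>G\<close> on every finite sum of norms controls the partial sums along
  any enumeration of \<open>A\<close>, both pointwise and after integration. The index set is kept
  general so that pairs of indices can be summed at once.\<close>

lemma has_sum_integral_dominated:
  fixes f :: "'i \<Rightarrow> 'a \<Rightarrow> 'b :: {banach, second_countable_topology}"
  assumes A: "countable A"
    and f [measurable]: "\<And>i. i \<in> A \<Longrightarrow> f i \<in> borel_measurable M"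
    and G: "integrable M G"
    and bound: "\<And>F x. finite F \<Longrightarrow> F \<subseteq> A \<Longrightarrow> x \<in> space M \<Longrightarrow> (\<Sum>i\<in>F. norm (f i x)) \<le> G x"
    and g: "\<And>x. x \<in> space M \<Longrightarrow> ((\<lambda>i. f i x) has_sum g x) A"
  shows "((\<lambda>i. integral\<^sup>L M (f i)) has_sum integral\<^sup>L M g) A"
proof -
  have int: "integrable M (f i)" if "i \<in> A" for i
    by (rule Bochner_Integration.integrable_bound[OF G f[OF that]])
       (use bound[of "{i}"] that in \<open>fastforce intro!: AE_I2\<close>)
  show ?thesis
  proof (cases "finite A")
    case True
    have "integral\<^sup>L M g = integral\<^sup>L M (\<lambda>x. \<Sum>i\<in>A. f i x)"
      by (intro Bochner_Integration.integral_cong refl)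
         (use g True in \<open>blast intro: has_sum_unique has_sum_finite\<close>)
    also have "\<dots> = (\<Sum>i\<in>A. integral\<^sup>L M (f i))"
      using int by (rule Bochner_Integration.integral_sum)
    finally show ?thesis
      using True by (simp add: has_sum_finite)
  next
    case False
    from countableE_infinite[OF A this] obtain e' :: "'i \<Rightarrow> nat" where "bij_betw e' A UNIV" .
    then obtain e :: "nat \<Rightarrow> 'i" where e: "bij_betw e UNIV A"
      using bij_betw_inv by blast
    have eA: "e k \<in> A" for k
      using e by (auto simp: bij_betw_def)
    \<comment> \<open>An initial segment of the enumeration is a sum over a finite subset of
      \<open>A\<close>, the form to which \<open>bound\<close> applies.\<close>
    have reindex: "(\<Sum>k<N. h (e k)) = sum h (e ` {..<N})" for h :: "'i \<Rightarrow> real" and N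
      using e by (subst sum.reindex) (auto simp: bij_betw_def intro: inj_on_subset)
    have part: "(\<Sum>k<N. norm (f (e k) x)) \<le> G x" if "x \<in> space M" for N x
      unfolding reindex[of "\<lambda>i. norm (f i x)"] by (rule bound) (use eA that in auto)
    have part_int: "(\<Sum>k<N. \<integral>x. norm (f (e k) x) \<partial>M) \<le> integral\<^sup>L M G" for N
    proof -
      have "(\<Sum>k<N. \<integral>x. norm (f (e k) x) \<partial>M) = (\<integral>x. (\<Sum>k<N. norm (f (e k) x)) \<partial>M)"
        by (subst Bochner_Integration.integral_sum) (use int eA in auto)
      also have "\<dots> \<le> integral\<^sup>L M G"
        by (rule integral_mono) (use int eA G part in auto)
      finally show ?thesis .
    qed
    have summ: "summable (\<lambda>k. norm (f (e k) x))" if "x \<in> space M" for x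
      by (rule summableI_nonneg_bounded[OF _ part[OF that]]) auto
    have summ_int: "summable (\<lambda>k. \<integral>x. norm (f (e k) x) \<partial>M)"
      by (rule summableI_nonneg_bounded[OF _ part_int]) auto
    have "(\<lambda>k. f (e k) x) sums g x" if "x \<in> space M" for x
      using g[OF that] has_sum_imp_sums has_sum_reindex_bij_betw[OF e, of "\<lambda>i. f i x"] by blast
    hence "integral\<^sup>L M g = (\<integral>x. (\<Sum>k. f (e k) x) \<partial>M)"
      by (intro Bochner_Integration.integral_cong refl) (simp add: sums_iff)
    moreover have "(\<lambda>k. integral\<^sup>L M (f (e k))) sums (\<integral>x. (\<Sum>k. f (e k) x) \<partial>M)"
      by (rule sums_integral) (use int eA summ summ_int in auto)
    \<comment> \<open>Termwise integration gives convergence only in the chosen order; absolute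
      summability makes it unconditional, hence independent of the enumeration.\<close>
    moreover have "summable (\<lambda>k. norm (integral\<^sup>L M (f (e k))))"
      by (rule summable_comparison_test'[OF summ_int, of 0]) auto
    ultimately have "((\<lambda>k. integral\<^sup>L M (f (e k))) has_sum integral\<^sup>L M g) UNIV"
      by (simp add: norm_summable_imp_has_sum)
    thus ?thesis
      using has_sum_reindex_bij_betw[OF e, of "\<lambda>i. integral\<^sup>L M (f i)"] by blast
  qed
qed

section \<open>Gaussian integrals with a linear term\<close>

lemma integrable_gaussian: "integrable lborel (\<lambda>x::real. exp (- x\<^sup>2 + 2 * b * x))"
proof -
  have eq: "exp (- x\<^sup>2 + 2 * b * x) = sqrt pi * exp (b\<^sup>2) * normal_density b (1 / sqrt 2) x" for x
    by (simp add: normal_density_def power_divide power2_diff algebra_simps flip: exp_add)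
  show ?thesis
    unfolding eq by (intro integrable_mult_right) auto
qed

text \<open>This is the characteristic function of the standard normal distribution at
  \<open>sqrt 2 * c\<close>. The substitution of \<open>sqrt 2 * x\<close> for \<open>x\<close>
  turns the weight \<open>exp (- x^2 / 2)\<close> into \<open>exp (- x^2)\<close>.\<close>

lemma integral_gaussian_oscillating:
  "(LINT x|lborel. exp (- of_real (x\<^sup>2) + 2 * \<i> * of_real (c * x))) =
     complex_of_real (sqrt pi * exp (- c\<^sup>2))"
proof -
  have "complex_of_real (exp (- c\<^sup>2)) = char std_normal_distribution (sqrt 2 * c)"
    by (simp add: char_std_normal_distribution power_mult_distrib)
  also have "\<dots> = (LINT x|lborel. std_normal_density x *\<^sub>R iexp (sqrt 2 * c * x))"
    unfolding char_def by (rule integral_density) auto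
  also have "\<dots> = sqrt 2 *\<^sub>R (LINT x|lborel. std_normal_density (0 + sqrt 2 * x) *\<^sub>R iexp (sqrt 2 * c * (0 + sqrt 2 * x)))"
    by (subst lborel_integral_real_affine[where c = "sqrt 2" and t = 0]) auto
  also have "(\<lambda>x. std_normal_density (0 + sqrt 2 * x) *\<^sub>R iexp (sqrt 2 * c * (0 + sqrt 2 * x))) =
      (\<lambda>x. of_real (1 / sqrt (2 * pi)) * exp (- of_real (x\<^sup>2) + 2 * \<i> * of_real (c * x)))"
  proof
    fix x :: real
    have "sqrt 2 * c * (0 + sqrt 2 * x) = 2 * (c * x)"
      by simp
    hence "iexp (sqrt 2 * c * (0 + sqrt 2 * x)) = exp (2 * \<i> * of_real (c * x))"
      by (simp only:) (simp add: mult_ac)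
    moreover have "complex_of_real (std_normal_density (0 + sqrt 2 * x)) =
        of_real (1 / sqrt (2 * pi)) * exp (- of_real (x\<^sup>2))"
      by (simp add: std_normal_density_def power_mult_distrib flip: exp_of_real)
    ultimately show "std_normal_density (0 + sqrt 2 * x) *\<^sub>R iexp (sqrt 2 * c * (0 + sqrt 2 * x)) =
      of_real (1 / sqrt (2 * pi)) * exp (- of_real (x\<^sup>2) + 2 * \<i> * of_real (c * x))"
      by (simp add: scaleR_conv_of_real mult_exp_exp del: of_real_divide)
  qed
  also have "sqrt 2 *\<^sub>R (LINT x|lborel. of_real (1 / sqrt (2 * pi)) * exp (- of_real (x\<^sup>2) + 2 * \<i> * of_real (c * x)))
    = of_real (1 / sqrt pi) * (LINT x|lborel. exp (- of_real (x\<^sup>2) + 2 * \<i> * of_real (c * x)))"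
    by (simp add: scaleR_conv_of_real real_sqrt_mult field_simps)
  finally show ?thesis
    by (simp add: field_simps)
qed

text \<open>Translating by the real part of \<open>a\<close> completes the square for that part over
  the real line. The imaginary part stays as an oscillating factor, which the previous lemma
  integrates.\<close>

lemma integral_gaussian_complex:
  "(LINT x|lborel. exp (- of_real (x\<^sup>2) + 2 * a * of_real x)) = of_real (sqrt pi) * exp ((a::complex)\<^sup>2)"
proof -
  obtain b c where a: "a = of_real b + \<i> * of_real c"
    using complex_eq by metis
  have "(LINT x|lborel. exp (- of_real (x\<^sup>2) + 2 * a * of_real x)) =
    (LINT x|lborel. exp (- of_real ((b + 1 * x)\<^sup>2) + 2 * a * of_real (b + 1 * x)))"
    by (subst lborel_integral_real_affine[where c = 1 and t = b]) simp_all
  also have "(\<lambda>x. exp (- of_real ((b + 1 * x)\<^sup>2) + 2 * a * of_real (b + 1 * x))) =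
     (\<lambda>x. exp (of_real (b\<^sup>2) + 2 * \<i> * of_real (b * c)) * exp (- of_real (x\<^sup>2) + 2 * \<i> * of_real (c * x)))"
    unfolding a mult_exp_exp by (intro ext arg_cong[of _ _ exp]) (simp add: power2_eq_square algebra_simps)
  also have "integral\<^sup>L lborel \<dots> = exp (of_real (b\<^sup>2) + 2 * \<i> * of_real (b * c)) * (of_real (sqrt pi) * exp (of_real (- c\<^sup>2)))"
    by (simp only: integral_mult_right_zero integral_gaussian_oscillating) (simp flip: exp_of_real)
  also have "\<dots> = of_real (sqrt pi) * exp (a\<^sup>2)"
    unfolding a by (simp add: mult.left_commute[of "exp _"] mult_exp_exp) (simp add: power2_eq_square algebra_simps)
  finally show ?thesis .
qed

section \<open>Hermite polynomials: generating function, recurrence and Rodrigues formula\<close>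

text \<open>
  \<open>fact n * hermite_coeff (-1) n (2 * x)\<close> is the $n$-th Hermite polynomial at $x$; the
  parameter $e$ in the generating function $\exp(ys + es^2)$ allows $e = 1$, which dominates $e = -1$ coefficientwise.
\<close>

definition hermite_coeff :: "'a::real_normed_field \<Rightarrow> nat \<Rightarrow> 'a \<Rightarrow> 'a" where
  "hermite_coeff e n y = (\<Sum>k\<le>n div 2. e ^ k / fact k * (y ^ (n - 2 * k) / fact (n - 2 * k)))"

text \<open>The product of the series of \<open>exp (e * s^2)\<close> and \<open>exp (y * s)\<close>
  is regrouped by the total power of \<open>s\<close>: the indices \<open>k\<close> and
  \<open>j\<close> contribute to \<open>n = j + 2 * k\<close>.\<close>

lemma has_sum_hermite_coeff:
  fixes e s y :: complex
  shows "((\<lambda>n. s ^ n * hermite_coeff e n y) has_sum exp (y * s + e * s\<^sup>2)) UNIV"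
proof -
  let ?F = "\<lambda>(k, j). (e * s\<^sup>2) ^ k / fact k * ((y * s) ^ j / fact j)"
  let ?G = "\<lambda>(n, k). s ^ n * (e ^ k / fact k * (y ^ (n - 2 * k) / fact (n - 2 * k)))"
  let ?B = "SIGMA n:UNIV. {..n div 2}"
  have F: "(?F has_sum exp (y * s + e * s\<^sup>2)) UNIV"
    using has_sum_mult_Times[OF has_sum_exp_complex[of "e * s\<^sup>2"] has_sum_exp_complex[of "y * s"]]
    by (simp add: mult_exp_exp add.commute)
  have bij: "bij_betw (\<lambda>(n::nat, k::nat). (k, n - 2 * k)) ?B UNIV"
    by (rule bij_betw_byWitness[where f' = "\<lambda>(k, j). (j + 2 * k, k)"]) auto
  have "((\<lambda>x. ?F (case x of (n, k) \<Rightarrow> (k, n - 2 * k))) has_sum exp (y * s + e * s\<^sup>2)) ?B"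
    using F has_sum_reindex_bij_betw[OF bij] by blast
  moreover have "?F (case x of (n, k) \<Rightarrow> (k, n - 2 * k)) = ?G x" if x: "x \<in> ?B" for x
  proof -
    obtain j k where x: "x = (j + 2 * k, k)"
      using x by (cases x) (metis (no_types, lifting) SigmaE atMost_iff less_eq_div_iff_mult_less_eq
          le_add_diff_inverse2 mult.commute prod.inject zero_less_numeral)
    show ?thesis
      unfolding x by (simp add: power_mult_distrib power_add mult_ac flip: power_mult)
  qed
  ultimately have "(?G has_sum exp (y * s + e * s\<^sup>2)) ?B"
    by (simp cong: has_sum_cong)
  from has_sum_SigmaD[OF this, of "\<lambda>n. \<Sum>k\<le>n div 2. ?G (n, k)"] show ?thesis
    by (simp add: hermite_coeff_def sum_distrib_left has_sum_finite)
qed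

text \<open>In each summand the factor \<open>n + 2\<close> is split as
  \<open>(n + 2 - 2 * k) + 2 * k\<close>. The first part cancels against the factorial under the
  power of \<open>y\<close>, the second against \<open>fact k\<close>.\<close>

lemma hermite_coeff_Suc:
  "of_nat (Suc (Suc n)) * hermite_coeff e (Suc (Suc n)) y =
     y * hermite_coeff e (Suc n) y + 2 * e * hermite_coeff e n y"
proof -
  let ?N = "Suc (Suc n)"
  let ?t = "\<lambda>k. e ^ k / fact k * (y ^ (?N - 2 * k) / fact (?N - 2 * k))"
  have "of_nat ?N * hermite_coeff e ?N y =
      (\<Sum>k\<le>?N div 2. of_nat (?N - 2 * k) * ?t k) + (\<Sum>k\<le>?N div 2. of_nat (2 * k) * ?t k)"
    unfolding hermite_coeff_def sum_distrib_left sum.distrib[symmetric] distrib_right[symmetric] of_nat_add[symmetric]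
    by (intro sum.cong refl) auto
  \<comment> \<open>The ranges differ only for even \<open>n\<close>, where the extra index
    satisfies \<open>2 * k = ?N\<close> and its term has the factor 0.\<close>
  also have "(\<Sum>k\<le>?N div 2. of_nat (?N - 2 * k) * ?t k) = (\<Sum>k\<le>Suc n div 2. of_nat (?N - 2 * k) * ?t k)"
    by (rule sum.mono_neutral_right) auto
  also have "\<dots> = y * hermite_coeff e (Suc n) y"
    unfolding hermite_coeff_def sum_distrib_left
  proof (intro sum.cong refl)
    fix k assume "k \<in> {..Suc n div 2}"
    then obtain j where j: "Suc n = j + 2 * k"
      by (metis atMost_iff less_eq_div_iff_mult_less_eq le_add_diff_inverse2 mult.commute zero_less_numeral)
    show "of_nat (?N - 2 * k) * ?t k = y * (e ^ k / fact k * (y ^ (Suc n - 2 * k) / fact (Suc n - 2 * k)))"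
      unfolding j by (simp add: field_simps del: of_nat_Suc)
  qed
  \<comment> \<open>The term at \<open>k = 0\<close> vanishes, so the index can be shifted by
    one.\<close>
  also have "(\<Sum>k\<le>?N div 2. of_nat (2 * k) * ?t k) = (\<Sum>k\<le>n div 2. of_nat (2 * Suc k) * ?t (Suc k))"
  proof -
    have "?N div 2 = Suc (n div 2)" by simp
    thus ?thesis
      by (simp only: sum.atMost_Suc_shift) simp
  qed
  also have "\<dots> = 2 * e * hermite_coeff e n y"
    unfolding hermite_coeff_def sum_distrib_left
  proof (intro sum.cong refl)
    fix k
    have "?N - 2 * Suc k = n - 2 * k" by simp
    thus "of_nat (2 * Suc k) * ?t (Suc k) = 2 * e * (e ^ k / fact k * (y ^ (n - 2 * k) / fact (n - 2 * k)))"
      by (simp only: of_nat_mult fact_Suc power_Suc) (simp add: field_simps del: of_nat_Suc)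
  qed
  finally show ?thesis .
qed

text \<open>Differentiating \<open>exp (y * s + e * s^2)\<close> in \<open>y\<close> multiplies it
  by \<open>s\<close>, which lowers the coefficient index by one. The proof carries this out
  termwise on the finite sum.\<close>

lemma hermite_coeff_has_field_derivative:
  "(hermite_coeff e (Suc n) has_field_derivative hermite_coeff e n y) (at y)"
proof -
  let ?t = "\<lambda>k. e ^ k / fact k * (of_nat (Suc n - 2 * k) * y ^ (Suc n - 2 * k - Suc 0) / fact (Suc n - 2 * k))"
  \<comment> \<open>For odd \<open>n\<close> the last term comes from a constant in
    \<open>y\<close>, so its derivative is 0.\<close>
  have "(\<Sum>k\<le>Suc n div 2. ?t k) = (\<Sum>k\<le>n div 2. ?t k)"
    by (rule sum.mono_neutral_right) auto
  also have "\<dots> = hermite_coeff e n y"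
    unfolding hermite_coeff_def
  proof (intro sum.cong refl)
    fix k assume "k \<in> {..n div 2}"
    hence "Suc n - 2 * k = Suc (n - 2 * k)" by auto
    thus "?t k = e ^ k / fact k * (y ^ (n - 2 * k) / fact (n - 2 * k))"
      by (simp del: of_nat_Suc)
  qed
  finally have eq: "(\<Sum>k\<le>Suc n div 2. ?t k) = hermite_coeff e n y" .
  have "((\<lambda>y. hermite_coeff e (Suc n) y) has_field_derivative (\<Sum>k\<le>Suc n div 2. ?t k)) (at y)"
    unfolding hermite_coeff_def
    by (intro DERIV_sum DERIV_cmult DERIV_cdivide) (rule DERIV_power[OF DERIV_ident, simplified])
  thus ?thesis
    by (simp only: eq)
qed

lemma norm_hermite_coeff_le: "norm (hermite_coeff e n y) \<le> hermite_coeff (norm e) n (norm y)"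
  unfolding hermite_coeff_def
  by (rule order_trans[OF norm_sum]) (simp add: norm_mult norm_divide norm_power)

lemma of_real_hermite_coeff: "of_real (hermite_coeff e n y) = hermite_coeff (of_real e) n (of_real y)"
  by (simp add: hermite_coeff_def)

text \<open>This ties the Rodrigues formula in \<open>hermite_poly\<close> to the explicit
  coefficients. By the product rule, one more derivative produces the right-hand side of the
  three-term recurrence at \<open>e = -1\<close>.\<close>

lemma deriv_iterate_exp_neg_square:
  "(deriv ^^ n) (\<lambda>t::real. exp (- t\<^sup>2)) =
     (\<lambda>x. (-1) ^ n * fact n * hermite_coeff (-1) n (2 * x) * exp (- x\<^sup>2))"
proof (induction n)
  case 0
  show ?case by (simp add: hermite_coeff_def)
next
  case (Suc n)
  show ?case
  proof
    fix x :: real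
    let ?A = "\<lambda>n. hermite_coeff (-1) n :: real \<Rightarrow> real"
    \<comment> \<open>\<open>D\<close> is the coefficient of index \<open>n - 1\<close>, read as 0
      for \<open>n = 0\<close>. The recurrence and the derivative rule cover only positive
      \<open>n\<close>, hence the case split.\<close>
    obtain D where D: "(?A n has_field_derivative D) (at (2 * x))"
      and rec: "of_nat (Suc n) * ?A (Suc n) (2 * x) = 2 * x * ?A n (2 * x) - 2 * D"
    proof (cases n)
      case 0
      show ?thesis
        by (rule that[of 0]) (simp_all add: 0 hermite_coeff_def[abs_def])
    next
      case (Suc k)
      show ?thesis
        by (rule that[of "?A k (2 * x)"])
           (use hermite_coeff_has_field_derivative hermite_coeff_Suc[of k "-1" "2 * x"] in \<open>simp_all add: Suc\<close>)
    qed
    have D2: "((\<lambda>x. ?A n (2 * x)) has_field_derivative D * 2) (at x)"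
      by (rule DERIV_chain2[where g = "\<lambda>x. 2 * x", OF D]) (auto intro!: derivative_eq_intros)
    have E2: "((\<lambda>x. exp (- x\<^sup>2)) has_field_derivative - 2 * x * exp (- x\<^sup>2)) (at x)"
      by (auto intro!: derivative_eq_intros)
    have "((\<lambda>x. (-1) ^ n * fact n * ?A n (2 * x) * exp (- x\<^sup>2)) has_field_derivative
        (-1) ^ n * fact n * (D * 2 * exp (- x\<^sup>2) - 2 * x * ?A n (2 * x) * exp (- x\<^sup>2))) (at x)"
      by (rule DERIV_cong[OF DERIV_mult[OF DERIV_cmult[OF D2] E2]]) (simp add: algebra_simps)
    also have "(-1) ^ n * fact n * (D * 2 * exp (- x\<^sup>2) - 2 * x * ?A n (2 * x) * exp (- x\<^sup>2)) =
        (-1) ^ Suc n * fact n * (2 * x * ?A n (2 * x) - 2 * D) * exp (- x\<^sup>2)"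
      by (simp add: algebra_simps)
    also have "\<dots> = (-1) ^ Suc n * fact (Suc n) * ?A (Suc n) (2 * x) * exp (- x\<^sup>2)"
      unfolding rec[symmetric] fact_Suc by (simp only: mult_ac)
    finally show "(deriv ^^ Suc n) (\<lambda>t. exp (- t\<^sup>2)) x = \<dots>"
      by (simp add: Suc DERIV_imp_deriv)
  qed
qed

section \<open>Generating function and domination for Hermite functions\<close>

lemma hermite_fun_eq: "hermite_fun n x = fact n * (exp (- x\<^sup>2 / 2) * hermite_coeff (-1) n (2 * x))"
proof -
  have "hermite_poly n x = (-1) ^ n * ((-1) ^ n * fact n * hermite_coeff (-1) n (2 * x)) * (exp (x\<^sup>2) * exp (- x\<^sup>2))"
    unfolding hermite_poly_def deriv_iterate_exp_neg_square by (simp only: mult_ac)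
  also have "\<dots> = fact n * hermite_coeff (-1) n (2 * x)"
    by (simp add: mult_exp_exp flip: power_mult_distrib mult.assoc)
  finally show ?thesis
    by (simp add: hermite_fun_def)
qed

lemma borel_measurable_hermite_fun [measurable]: "hermite_fun n \<in> borel_measurable borel"
  unfolding hermite_fun_eq[abs_def] hermite_coeff_def
  by (intro borel_measurable_continuous_onI continuous_intros) auto

lemma has_sum_hermite_fun:
  "((\<lambda>n. s ^ n / fact n * complex_of_real (hermite_fun n x)) has_sum
     exp (- of_real (x\<^sup>2) / 2 + 2 * of_real x * s - s\<^sup>2)) UNIV"
  using has_sum_cmult_right[OF has_sum_hermite_coeff[of s "-1" "2 * of_real x"], of "exp (- of_real (x\<^sup>2) / 2)"]
  by (simp add: hermite_fun_eq of_real_hermite_coeff mult_exp_exp mult_ac exp_of_real[symmetric] algebra_simps)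

lemma sum_norm_hermite_fun_le:
  assumes "finite B"
  shows "(\<Sum>n\<in>B. norm (s ^ n / fact n * complex_of_real (hermite_fun n x)))
     \<le> exp (- x\<^sup>2 / 2 + 2 * \<bar>x\<bar> * norm s + (norm s)\<^sup>2)"
proof -
  \<comment> \<open>With \<open>e = 1\<close> and nonnegative real arguments every term is a
    nonnegative real. The complex identity thus descends to the reals, where the full sum bounds
    each finite partial sum.\<close>
  have "((\<lambda>n. complex_of_real (norm s ^ n * hermite_coeff 1 n (2 * \<bar>x\<bar>)))
      has_sum of_real (exp (2 * \<bar>x\<bar> * norm s + (norm s)\<^sup>2))) UNIV"
    using has_sum_hermite_coeff[of "of_real (norm s)" 1 "of_real (2 * \<bar>x\<bar>)"]
    by (simp add: of_real_hermite_coeff flip: exp_of_real)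
  hence *: "((\<lambda>n. norm s ^ n * hermite_coeff 1 n (2 * \<bar>x\<bar>))
      has_sum exp (2 * \<bar>x\<bar> * norm s + (norm s)\<^sup>2)) UNIV"
    by (simp only: has_sum_of_real_iff)
  have nonneg: "0 \<le> hermite_coeff 1 n (2 * \<bar>x\<bar>)" for n
    by (simp add: hermite_coeff_def sum_nonneg)
  have "norm (s ^ n / fact n * complex_of_real (hermite_fun n x)) \<le>
      exp (- x\<^sup>2 / 2) * (norm s ^ n * hermite_coeff 1 n (2 * \<bar>x\<bar>))" for n
    using norm_hermite_coeff_le[of "-1" n "2 * x"]
    by (simp add: hermite_fun_eq norm_mult norm_divide norm_power abs_mult mult_ac mult_left_mono)
  hence "(\<Sum>n\<in>B. norm (s ^ n / fact n * complex_of_real (hermite_fun n x))) \<le>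
      exp (- x\<^sup>2 / 2) * (\<Sum>n\<in>B. norm s ^ n * hermite_coeff 1 n (2 * \<bar>x\<bar>))"
    unfolding sum_distrib_left by (rule sum_mono)
  also have "\<dots> \<le> exp (- x\<^sup>2 / 2) * exp (2 * \<bar>x\<bar> * norm s + (norm s)\<^sup>2)"
    by (intro mult_left_mono finite_sum_le_has_sum[OF * assms]) (auto simp: nonneg)
  finally show ?thesis
    by (simp add: mult_exp_exp algebra_simps)
qed

section \<open>Double generating function of the Fourier-Wigner transforms\<close>

text \<open>A finite set of pairs lies in the rectangle spanned by its two projections, over which
  the sum factors.\<close>

lemma sum_mult_le_product_of_bounds:
  fixes a :: "'a \<Rightarrow> real" and b :: "'b \<Rightarrow> real"
  assumes "finite F"
    and nonneg: "\<And>i. 0 \<le> a i" "\<And>j. 0 \<le> b j"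
    and bound: "\<And>A. finite A \<Longrightarrow> sum a A \<le> S" "\<And>B. finite B \<Longrightarrow> sum b B \<le> T"
  shows "(\<Sum>(i, j)\<in>F. a i * b j) \<le> S * T"
proof -
  have "(\<Sum>(i, j)\<in>F. a i * b j) \<le> (\<Sum>(i, j)\<in>fst ` F \<times> snd ` F. a i * b j)"
    by (rule sum_mono2) (use assms in \<open>auto simp: subset_fst_snd\<close>)
  also have "\<dots> = sum a (fst ` F) * sum b (snd ` F)"
    by (simp add: sum_product sum.cartesian_product)
  also have "\<dots> \<le> S * T"
    \<comment> \<open>The bound at the empty set yields \<open>0 \<le> S\<close>, which monotonicity
      of the product requires.\<close>
    using assms by (intro mult_mono bound sum_nonneg order_trans[OF sum_nonneg bound(1)[OF finite.emptyI]]) auto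
  finally show ?thesis .
qed

text \<open>This supplies the integrable majorant for the exchange of sum and integral. The absolute
  values are removed by comparison with a sum of two Gaussians, one for each sign of
  \<open>x\<close>.\<close>

lemma integrable_gaussian_shifted_product:
  fixes p r r' :: real
  assumes "0 \<le> r" "0 \<le> r'"
  shows "integrable lborel (\<lambda>x. exp (- (x + p)\<^sup>2 / 2 + 2 * \<bar>x + p\<bar> * r + r\<^sup>2) * exp (- x\<^sup>2 / 2 + 2 * \<bar>x\<bar> * r' + r'\<^sup>2))"
proof (rule Bochner_Integration.integrable_bound)
  \<comment> \<open>After \<open>\<bar>x + p\<bar> \<le> \<bar>x\<bar> + \<bar>p\<bar>\<close>,
    \<open>C\<close> collects the factors independent of \<open>x\<close>. What remains is
    \<open>exp (- x^2 - p * x + 2 * \<bar>x\<bar> * k)\<close>, equal to the first summand of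
    \<open>?H / C\<close> for \<open>x \<ge> 0\<close> and to the second for
    \<open>x < 0\<close>.\<close>
  define C where "C = exp (- p\<^sup>2 / 2 + 2 * \<bar>p\<bar> * r + r\<^sup>2 + r'\<^sup>2)"
  define k where "k = r + r'"
  let ?H = "\<lambda>x. C * (exp (- x\<^sup>2 + 2 * (k - p / 2) * x) + exp (- x\<^sup>2 + 2 * (- k - p / 2) * x))"
  show "integrable lborel ?H"
    by (intro integrable_mult_right Bochner_Integration.integrable_add integrable_gaussian)
  show "AE x in lborel. norm (exp (- (x + p)\<^sup>2 / 2 + 2 * \<bar>x + p\<bar> * r + r\<^sup>2) * exp (- x\<^sup>2 / 2 + 2 * \<bar>x\<bar> * r' + r'\<^sup>2)) \<le> norm (?H x)"
  proof (rule AE_I2)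
    fix x
    have "\<bar>x + p\<bar> * r \<le> (\<bar>x\<bar> + \<bar>p\<bar>) * r"
      using assms by (intro mult_right_mono) auto
    hence "exp (- (x + p)\<^sup>2 / 2 + 2 * \<bar>x + p\<bar> * r + r\<^sup>2) * exp (- x\<^sup>2 / 2 + 2 * \<bar>x\<bar> * r' + r'\<^sup>2)
        \<le> C * exp (- x\<^sup>2 - p * x + 2 * \<bar>x\<bar> * k)"
      unfolding C_def k_def mult_exp_exp exp_le_cancel_iff by (simp add: power2_sum field_simps)
    also have "exp (- x\<^sup>2 - p * x + 2 * \<bar>x\<bar> * k) \<le> exp (- x\<^sup>2 + 2 * (k - p / 2) * x) + exp (- x\<^sup>2 + 2 * (- k - p / 2) * x)"
      by (cases "x \<ge> 0") (auto simp: algebra_simps)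
    finally show "norm (exp (- (x + p)\<^sup>2 / 2 + 2 * \<bar>x + p\<bar> * r + r\<^sup>2) * exp (- x\<^sup>2 / 2 + 2 * \<bar>x\<bar> * r' + r'\<^sup>2)) \<le> norm (?H x)"
      by (simp add: C_def add_pos_pos abs_mult)
  qed
qed measurable

lemma has_sum_fourier_wigner_hermite_fun:
  fixes p q :: real and s t :: complex
  shows "((\<lambda>(m, n). s ^ m / fact m * (t ^ n / fact n) *
            fourier_wigner (\<lambda>x. of_real (hermite_fun m x)) (\<lambda>x. of_real (hermite_fun n x)) p q) has_sum
          of_real (exp (- (p\<^sup>2 + q\<^sup>2) / 4)) / of_real (sqrt 2) *
          exp (2 * s * t + (of_real p + \<i> * of_real q) * s - (of_real p - \<i> * of_real q) * t)) UNIV"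
proof -
  let ?e = "\<lambda>x. exp (\<i> * complex_of_real ((x + p / 2) * q))"
  let ?a = "\<lambda>m x. s ^ m / fact m * complex_of_real (hermite_fun m (x + p))"
  let ?b = "\<lambda>n x. t ^ n / fact n * complex_of_real (hermite_fun n x)"
  let ?f = "\<lambda>(m, n) x. ?e x * (?a m x * ?b n x)"
  let ?g = "\<lambda>x. ?e x * (exp (- of_real ((x + p)\<^sup>2) / 2 + 2 * of_real (x + p) * s - s\<^sup>2)
                       * exp (- of_real (x\<^sup>2) / 2 + 2 * of_real x * t - t\<^sup>2))"
  let ?G = "\<lambda>x. exp (- (x + p)\<^sup>2 / 2 + 2 * \<bar>x + p\<bar> * norm s + (norm s)\<^sup>2)
               * exp (- x\<^sup>2 / 2 + 2 * \<bar>x\<bar> * norm t + (norm t)\<^sup>2)"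
  have "((\<lambda>i. integral\<^sup>L lborel (?f i)) has_sum integral\<^sup>L lborel ?g) UNIV"
  proof (rule has_sum_integral_dominated[where G = ?G])
    show "integrable lborel ?G"
      by (rule integrable_gaussian_shifted_product) auto
    show "?f i \<in> borel_measurable lborel" for i
      by (cases i) simp
    show "(\<Sum>i\<in>F. norm (?f i x)) \<le> ?G x" if "finite F" for F x
    proof -
      have "(\<Sum>i\<in>F. norm (?f i x)) = (\<Sum>(m, n)\<in>F. norm (?a m x) * norm (?b n x))"
        by (intro sum.cong refl) (auto simp only: norm_mult norm_exp_i_times mult_1 split: prod.split)
      also have "\<dots> \<le> ?G x"
        by (rule sum_mult_le_product_of_bounds[OF that]) (simp_all only: norm_ge_zero sum_norm_hermite_fun_le)
      finally show ?thesis .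
    qed
    show "((\<lambda>i. ?f i x) has_sum ?g x) UNIV" for x
      using has_sum_cmult_right[OF has_sum_mult_Times[OF has_sum_hermite_fun[of s "x + p"] has_sum_hermite_fun[of t x]], of "?e x"]
      by (simp add: case_prod_unfold)
  qed auto
  hence "((\<lambda>i. 1 / complex_of_real (sqrt (2 * pi)) * integral\<^sup>L lborel (?f i)) has_sum
      1 / complex_of_real (sqrt (2 * pi)) * integral\<^sup>L lborel ?g) UNIV"
    by (rule has_sum_cmult_right)
  also have "(\<lambda>i. 1 / complex_of_real (sqrt (2 * pi)) * integral\<^sup>L lborel (?f i)) =
      (\<lambda>(m, n). s ^ m / fact m * (t ^ n / fact n) *
            fourier_wigner (\<lambda>x. of_real (hermite_fun m x)) (\<lambda>x. of_real (hermite_fun n x)) p q)"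
  proof
    fix i :: "nat \<times> nat"
    obtain m n where i: "i = (m, n)" by (cases i)
    have "integral\<^sup>L lborel (?f (m, n)) = s ^ m / fact m * (t ^ n / fact n) *
       (LINT x|lborel. ?e x * of_real (hermite_fun m (x + p)) * cnj (of_real (hermite_fun n x)))"
      by (subst integral_mult_right_zero[symmetric]) (simp add: mult_ac)
    \<comment> \<open>The integrand is Borel measurable, so passing to the completed measure does
      not change the integral.\<close>
    also have "(LINT x|lborel. ?e x * of_real (hermite_fun m (x + p)) * cnj (of_real (hermite_fun n x))) =
       (LINT x|lebesgue. ?e x * of_real (hermite_fun m (x + p)) * cnj (of_real (hermite_fun n x)))"
      by (rule integral_completion[symmetric]) simp
    finally show "1 / complex_of_real (sqrt (2 * pi)) * integral\<^sup>L lborel (?f i) =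
       (case i of (m, n) \<Rightarrow> s ^ m / fact m * (t ^ n / fact n) *
            fourier_wigner (\<lambda>x. of_real (hermite_fun m x)) (\<lambda>x. of_real (hermite_fun n x)) p q)"
      by (simp only: i case_prod_conv fourier_wigner_def mult_ac)
  qed
  also have "1 / complex_of_real (sqrt (2 * pi)) * integral\<^sup>L lborel ?g =
     of_real (exp (- (p\<^sup>2 + q\<^sup>2) / 4)) / of_real (sqrt 2) *
     exp (2 * s * t + (of_real p + \<i> * of_real q) * s - (of_real p - \<i> * of_real q) * t)"
  proof -
    \<comment> \<open>In the exponent of \<open>?g\<close> the coefficient of \<open>x\<close> is
      \<open>2 * a\<close> and the part free of \<open>x\<close> is \<open>c\<close>.\<close>
    define a where "a = s + t + (\<i> * of_real q - of_real p) / 2"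
    define c where "c = \<i> * of_real p * of_real q / 2 - (of_real p)\<^sup>2 / 2 + 2 * of_real p * s - s\<^sup>2 - t\<^sup>2"
    have "?g = (\<lambda>x. exp c * exp (- of_real (x\<^sup>2) + 2 * a * of_real x))"
      unfolding a_def c_def mult_exp_exp
      by (intro ext arg_cong[of _ _ exp]) (simp add: power2_eq_square field_simps)
    hence "integral\<^sup>L lborel ?g = of_real (sqrt pi) * exp (c + a\<^sup>2)"
      by (simp only: integral_mult_right_zero integral_gaussian_complex) (simp add: exp_add)
    \<comment> \<open>The cross term of \<open>a^2\<close> cancels the phase
      \<open>i * p * q / 2\<close>; this is the effect of the symmetric shift
      \<open>x + p / 2\<close> in the transform.\<close>
    also have "c + a\<^sup>2 = of_real (- (p\<^sup>2 + q\<^sup>2) / 4) +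
        (2 * s * t + (of_real p + \<i> * of_real q) * s - (of_real p - \<i> * of_real q) * t)"
      unfolding a_def c_def by (simp add: power2_eq_square field_simps)
    finally show ?thesis
      by (simp only: exp_add exp_of_real) (simp add: real_sqrt_mult)
  qed
  finally show ?thesis .
qed

section \<open>Comparison of coefficients\<close>

theorem theorem4p1:
  fixes m n :: nat and p q :: real
  shows "fourier_wigner (\<lambda>x. complex_of_real (hermite_fun m x))
                        (\<lambda>x. complex_of_real (hermite_fun n x)) p q =
    (-1) ^ n * complex_of_real (sqrt 2 powi (int m + int n - 1)) *
    complex_of_real (exp (- (p\<^sup>2 + q\<^sup>2) / 4)) *
    complex_hermite m n
      ((complex_of_real p + \<i> * complex_of_real q) / complex_of_real (sqrt 2))
      ((complex_of_real p - \<i> * complex_of_real q) / complex_of_real (sqrt 2))"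
proof -
  define V where "V m n = fourier_wigner (\<lambda>x. complex_of_real (hermite_fun m x))
                        (\<lambda>x. complex_of_real (hermite_fun n x)) p q" for m n
  define R where "R = complex_of_real (sqrt 2)"
  define E where "E = complex_of_real (exp (- (p\<^sup>2 + q\<^sup>2) / 4))"
  define z where "z = (complex_of_real p + \<i> * complex_of_real q) / R"
  define w where "w = (complex_of_real p - \<i> * complex_of_real q) / R"
  \<comment> \<open>\<open>c\<close> is the claimed identity solved for the complex Hermite value.
    The factor \<open>(-1) ^ n / R ^ (m + n)\<close> comes from \<open>s = u / R\<close>,
    \<open>t = - v / R\<close>, and \<open>R / E\<close> inverts the Gaussian prefactor.\<close>
  define c where "c m n = R / E * ((-1) ^ n / R ^ (m + n)) * V m n" for m n
  have R: "R \<noteq> 0" "R * R = 2" and E: "E \<noteq> 0"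
    by (simp_all add: R_def E_def flip: of_real_mult)
  have "is_complex_hermite_family z w c"
    unfolding is_complex_hermite_family_def
  proof (intro allI)
    fix u v
    have exponent: "2 * (u / R) * (- v / R) + (of_real p + \<i> * of_real q) * (u / R)
        - (of_real p - \<i> * of_real q) * (- v / R) = - u * v + z * u + w * v"
      using R by (simp add: z_def w_def field_simps)
    have "((\<lambda>(m, n). (u / R) ^ m / fact m * ((- v / R) ^ n / fact n) * V m n) has_sum
        E / R * exp (- u * v + z * u + w * v)) UNIV"
      using has_sum_fourier_wigner_hermite_fun[of "u / R" "- v / R" p q]
      unfolding R_def[symmetric] E_def[symmetric] V_def[symmetric] exponent .
    from has_sum_cmult_right[OF this, of "R / E"]
    have "((\<lambda>x. R / E * (case x of (m, n) \<Rightarrow> (u / R) ^ m / fact m * ((- v / R) ^ n / fact n) * V m n)) has_sum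
        exp (- u * v + z * u + w * v)) UNIV"
      using R E by simp
    also have "(\<lambda>x. R / E * (case x of (m, n) \<Rightarrow> (u / R) ^ m / fact m * ((- v / R) ^ n / fact n) * V m n)) =
        (\<lambda>(m, n). u ^ m / fact m * (v ^ n / fact n) * c m n)"
      by (auto simp: fun_eq_iff c_def power_divide power_add power_minus[of "v / R"] field_simps)
    finally show "((\<lambda>(m, n). u ^ m / fact m * (v ^ n / fact n) * c m n) has_sum exp (- u * v + z * u + w * v)) UNIV" .
  qed
  \<comment> \<open>Uniqueness of the family with this generating function identifies
    \<open>c\<close>.\<close>
  hence hermite: "complex_hermite m n z w = c m n"
    unfolding complex_hermite_def using the1_equality[OF complex_hermite_family_ex1] by metis
  \<comment> \<open>The integer power matters at \<open>m = n = 0\<close>, where the exponent is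
    -1.\<close>
  have power: "complex_of_real (sqrt 2 powi (int m + int n - 1)) = R ^ (m + n) / R"
    by (simp add: power_int_diff power_int_add R_def power_add)
  show ?thesis
    using R E unfolding V_def[symmetric] R_def[symmetric] E_def[symmetric] z_def[symmetric] w_def[symmetric]
    by (simp only: power hermite) (simp add: c_def field_simps flip: power_mult_distrib)
qed

end
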